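(* Let $A,B\in\mathbb{C}_{n,n}$. Then $A\overset{\mathtt{CM}}{\le}B$ if and only if $$A\overset{(\dag)}{\le}B\quad\text{and}\quad A-AA^{(\dag)}A\overset{-}{\le}B-BB^{(\dag)}B.$$
   Context: $\mathbb{C}_{n,n}$ is the set of $n\times n$ complex matrices, $A^\ast$ is the conjugate transpose, $\mathrm{rk}$ the rank, $\mathcal{R}(A)$ the column space, $A^\dag$ the Moore-Penrose inverse. The index $\mathrm{Ind}(A)$ is $0$ if $A$ is non-singular, and otherwise is the smallest positive integer $k$ with $\mathrm{rk}(A^{k+1})=\mathrm{rk}(A^k)$. $\mathbb{C}_n^{\mathtt{CM}}=\{A\in\mathbb{C}_{n,n} : \mathrm{rk}(A^2)=\mathrm{rk}(A)\}$ (core-invertible matrices). Core-EP decomposition: for $A\in\mathbb{C}_{n,n}$ with $\mathrm{Ind}(A)=k$, it is the (existing and unique) decomposition $A=A_1+A_2$ with $A_1\in\mathbb{C}_n^{\mathtt{CM}}$, $A_2^k=0$ (read as $A_2=0$ when $k=0$), and $A_1^\ast A_2=A_2A_1=0$. Core inverse: for $A\in\mathbb{C}_n^{\mathtt{CM}}$, $A^{(\#)}$ is the unique $X\in\mathbb{C}_{n,n}$ with $AX=AA^\dag$ and $\mathcal{R}(X)\subseteq\mathcal{R}(A)$. Core partial order: for $A,B\in\mathbb{C}_n^{\mathtt{CM}}$, $A\overset{(\#)}{\le}B$ means $A^{(\#)}A=A^{(\#)}B$ and $AA^{(\#)}=BA^{(\#)}$. Minus partial order: $A\overset{-}{\le}B$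 means $\mathrm{rk}(B)-\mathrm{rk}(A)=\mathrm{rk}(B-A)$. Core-EP inverse: for $A\in\mathbb{C}_{n,n}$ with $\mathrm{Ind}(A)=k$, $A^{(\dag)}$ is the unique $X\in\mathbb{C}_{n,n}$ satisfying $XA^{k+1}=A^k$, $XAX=X$, $(AX)^\ast=AX$ and $\mathcal{R}(X)\subseteq\mathcal{R}(A^k)$. Core-EP order: for $A,B\in\mathbb{C}_{n,n}$, $A\overset{(\dag)}{\le}B$ means $A^{(\dag)}A=A^{(\dag)}B$ and $AA^{(\dag)}=BA^{(\dag)}$. Core-minus order: for $A,B\in\mathbb{C}_{n,n}$ with core-EP decompositions $A=A_1+A_2$ and $B=B_1+B_2$ ($A_1,B_1$ core-invertible, $A_2,B_2$ nilpotent), $A\overset{\mathtt{CM}}{\le}B$ means $A_1\overset{(\#)}{\le}B_1$ and $A_2\overset{-}{\le}B_2$. *)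

theory Defs
  imports "HOL-Analysis.Analysis"
begin

definition conj_transpose :: "complex^'n^'m \<Rightarrow> complex^'m^'n"  (\<open>(_\<^sup>H)\<close> [1000] 999)
  where "A\<^sup>H = map_matrix cnj (transpose A)"

(* The library's (^) on vectors of vectors is the entrywise power, so powers with respect to
   the matrix product ( ** ) are defined separately. *)
primrec mat_power :: "complex^'n^'n \<Rightarrow> nat \<Rightarrow> complex^'n^'n"
  where
    "mat_power A 0 = mat 1"
  | "mat_power A (Suc k) = A ** mat_power A k"

definition col_space :: "complex^'n^'m \<Rightarrow> (complex^'m) set"
  where "col_space A = vec.span (columns A)"

definition mat_index :: "complex^'n^'n \<Rightarrow> nat"
  where "mat_index A =
    (if invertible A then 0
     else LEAST k. 0 < k \<and> rank (mat_power A (k + 1)) = rank (mat_power A k))"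

definition core_invertible :: "complex^'n^'n \<Rightarrow> bool"
  where "core_invertible A \<longleftrightarrow> rank (mat_power A 2) = rank A"

definition moore_penrose :: "complex^'n^'m \<Rightarrow> complex^'m^'n"
  where "moore_penrose A =
    (THE X. A ** X ** A = A \<and> X ** A ** X = X \<and> (A ** X)\<^sup>H = A ** X \<and> (X ** A)\<^sup>H = X ** A)"

(* Meaningful only for core-invertible A; otherwise no such X exists. *)
definition core_inverse :: "complex^'n^'n \<Rightarrow> complex^'n^'n"
  where "core_inverse A =
    (THE X. A ** X = A ** moore_penrose A \<and> col_space X \<subseteq> col_space A)"

definition core_le :: "complex^'n^'n \<Rightarrow> complex^'n^'n \<Rightarrow> bool"
  where "core_le A B \<longleftrightarrow> core_invertible A \<and> core_invertible B \<and>
    core_inverse A ** A = core_inverse A ** B \<and> A ** core_inverse A = B ** core_inverse A"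

(* The difference of ranks is taken in the integers to avoid truncated subtraction. *)
definition minus_le :: "complex^'n^'m \<Rightarrow> complex^'n^'m \<Rightarrow> bool"
  where "minus_le A B \<longleftrightarrow> int (rank B) - int (rank A) = int (rank (B - A))"

(* For index 0 the condition "A2 to the power Ind A is 0" would read mat 1 = 0; there it means
   A2 = 0. *)
definition core_EP_decomposition ::
    "complex^'n^'n \<Rightarrow> complex^'n^'n \<Rightarrow> complex^'n^'n \<Rightarrow> bool"
  where "core_EP_decomposition A A1 A2 \<longleftrightarrow>
    A = A1 + A2 \<and> core_invertible A1 \<and>
    (if mat_index A = 0 then A2 = 0 else mat_power A2 (mat_index A) = 0) \<and>
    A1\<^sup>H ** A2 = 0 \<and> A2 ** A1 = 0"

definition core_EP_inverse :: "complex^'n^'n \<Rightarrow> complex^'n^'n"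
  where "core_EP_inverse A =
    (THE X. X ** mat_power A (mat_index A + 1) = mat_power A (mat_index A) \<and>
            X ** A ** X = X \<and> (A ** X)\<^sup>H = A ** X \<and>
            col_space X \<subseteq> col_space (mat_power A (mat_index A)))"

definition core_EP_le :: "complex^'n^'n \<Rightarrow> complex^'n^'n \<Rightarrow> bool"
  where "core_EP_le A B \<longleftrightarrow>
    core_EP_inverse A ** A = core_EP_inverse A ** B \<and>
    A ** core_EP_inverse A = B ** core_EP_inverse A"

(* Core-EP decompositions exist and are unique, so the existential quantifiers pick out the
   components of A and of B. *)
definition core_minus_le :: "complex^'n^'n \<Rightarrow> complex^'n^'n \<Rightarrow> bool"
  where "core_minus_le A B \<longleftrightarrow>
    (\<exists>A1 A2 B1 B2. core_EP_decomposition A A1 A2 \<and> core_EP_decomposition B B1 B2 \<and>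
      core_le A1 B1 \<and> minus_le A2 B2)"

end

(* If A = A1 + A2 is the core-EP decomposition, then the core inverse X of A1 satisfies the
   equations of the core-EP inverse of A, and A X A = A1. So A2 = A - A X A, and the two minus order
   conditions coincide. Since X A = X A1 and A X = A1 X, it remains to compare X B with X B1 and
   B X with B1 X, and these agree as soon as R(A1) is contained in R(B1). The inclusion is
   immediate from the core order of A1 and B1. From the core-EP order it follows because B A1 = A1^2,
   so R(A1) = R(A1^(m+1)) = R(B^m A1) lies in R(B^m), hence in R(B1), for m = Ind(B). *)

theory Submission
  imports Defs
begin

section \<open>Matrix algebra\<close>

lemma matrix_sub_ldistrib: "A ** (B - C) = A ** B - A ** C"
  for A :: "'a::ring_1^'n^'m"
  by (vector matrix_matrix_mult_def sum_subtractf[symmetric] algebra_simps)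

lemma matrix_sub_rdistrib: "(A - B) ** C = A ** C - B ** C"
  for A :: "'a::ring_1^'n^'m"
  by (vector matrix_matrix_mult_def sum_subtractf[symmetric] algebra_simps)

lemma matrix_add_rdistrib: "(A + B) ** C = A ** C + B ** C"
  for A :: "'a::semiring_1^'n^'m"
  by (vector matrix_matrix_mult_def sum.distrib[symmetric] algebra_simps)

text \<open>Lets a relation \<open>A ** B = C\<close> fire inside right-nested products.\<close>

lemma matrix_mul_prolong: "A ** B = C \<Longrightarrow> A ** (B ** D) = C ** D"
  by (simp add: matrix_mul_assoc)

lemma conj_transpose_mul: "(A ** B)\<^sup>H = B\<^sup>H ** A\<^sup>H"
  by (simp add: conj_transpose_def vec_eq_iff matrix_matrix_mult_def transpose_def mult.commute)

lemma conj_transpose_conj_transpose [simp]: "(A\<^sup>H)\<^sup>H = A"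
  by (simp add: conj_transpose_def vec_eq_iff transpose_def)

text \<open>Each diagonal entry of \<open>A\<^sup>H ** A\<close> is the squared norm of a column of
  \<open>A\<close>.\<close>

lemma conj_transpose_mul_self_eq_0:
  assumes "A\<^sup>H ** A = 0"
  shows "A = 0"
proof -
  have "A $ k $ i = 0" for k i
  proof -
    have "(A\<^sup>H ** A) $ i $ i = (\<Sum>k\<in>UNIV. complex_of_real ((cmod (A $ k $ i))\<^sup>2))"
      unfolding conj_transpose_def matrix_matrix_mult_def transpose_def
      by (simp only: map_matrix_def vec_lambda_beta complex_norm_square mult.commute)
    then have "complex_of_real (\<Sum>k\<in>UNIV. (cmod (A $ k $ i))\<^sup>2) = 0"
      using assms by simp
    then have "(\<Sum>k\<in>UNIV. (cmod (A $ k $ i))\<^sup>2) = 0"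
      using of_real_eq_0_iff by blast
    then show ?thesis
      by (simp add: sum_nonneg_eq_0_iff)
  qed
  then show ?thesis
    by (simp add: vec_eq_iff)
qed

lemma conj_transpose_mul_left_cancel:
  assumes "A\<^sup>H ** A ** X = A\<^sup>H ** A ** Y"
  shows "A ** X = A ** Y"
proof -
  have "A\<^sup>H ** (A ** (X - Y)) = 0"
    using assms by (simp add: matrix_sub_ldistrib matrix_mul_assoc)
  then have "(A ** (X - Y))\<^sup>H ** (A ** (X - Y)) = 0"
    by (simp add: conj_transpose_mul flip: matrix_mul_assoc)
  then have "A ** (X - Y) = 0"
    by (rule conj_transpose_mul_self_eq_0)
  then show ?thesis
    by (simp add: matrix_sub_ldistrib)
qed

lemma matrix_inner_inverse_exists:
  fixes A :: "'a::field^'n^'m"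
  obtains N where "A ** N ** A = A"
proof -
  \<comment> \<open>\<open>g\<close> is linear and picks a preimage for every vector in the range of
    \<open>A\<close>; its matrix is the inner inverse.\<close>
  obtain g where g: "Vector_Spaces.linear (*s) (*s) g" "\<forall>v\<in>range ((*v) A). A *v g v = v"
    using vec.linear_exists_right_inverse_on[OF matrix_vector_mul_linear_gen vec.subspace_UNIV]
    by metis
  have "A ** matrix g ** A = A"
    using g by (simp add: matrix_eq matrix_works flip: matrix_vector_mul_assoc)
  then show thesis
    using that by blast
qed

text \<open>With \<open>P\<close> a projector onto the range of \<open>A\<close>, the matrix \<open>A P + I - P\<close> is injective, hence
  invertible, and commutes with \<open>P\<close>.\<close>

lemma left_square_factor_imp_right:
  fixes A :: "'a::field^'n^'n"
  assumes "A = V ** A ** A"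
  obtains W where "A = A ** A ** W"
proof -
  obtain N where N: "A ** N ** A = A"
    using matrix_inner_inverse_exists .
  define P where "P = A ** N"
  define U where "U = A ** P + (mat 1 - P)"
  have PA: "P ** A = A"
    by (simp add: N P_def)
  have PP: "P ** P = P"
    by (metis N P_def matrix_mul_assoc)
  have UP: "U ** P = A ** P" and PU: "P ** U = A ** P"
    using PA PP by (simp_all add: U_def matrix_add_ldistrib matrix_add_rdistrib
        matrix_sub_ldistrib matrix_sub_rdistrib matrix_mul_prolong[OF PA] flip: matrix_mul_assoc)
  \<comment> \<open>Applying \<open>P\<close> to \<open>U *v x = 0\<close> gives
    \<open>A P x = 0\<close> and then \<open>P x = x\<close>. Since \<open>P = V A P\<close>, it
    follows that \<open>x = V A P x = 0\<close>.\<close>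
  have "x = 0" if "U *v x = 0" for x
  proof -
    have "(A ** P) *v x = P *v (U *v x)"
      by (simp add: PU matrix_vector_mul_assoc)
    then have APx: "(A ** P) *v x = 0"
      using that by simp
    then have "P *v x = x"
      using that by (simp add: U_def algebra_simps)
    moreover have "P = V ** A ** P"
      using assms by (metis P_def matrix_mul_assoc)
    ultimately show ?thesis
      using APx by (metis matrix_mul_assoc matrix_vector_mul_assoc matrix_vector_mult_0_right)
  qed
  then obtain U' where "U' ** U = mat 1"
    by (metis matrix_left_invertible_ker)
  then have U': "U ** U' = mat 1" "U' ** U = mat 1"
    by (simp_all add: matrix_left_right_inverse1)
  have "P ** U' = U' ** (U ** P) ** U'"
    using U' by (simp add: matrix_mul_assoc)
  also have "\<dots> = U' ** P"
    using U' UP PU by (metis matrix_mul_assoc matrix_mul_rid)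
  finally have comm: "P ** U' = U' ** P" .
  \<comment> \<open>Moving \<open>U'\<close> past \<open>P\<close> turns \<open>U P\<close> into
    \<open>A P = A A N\<close>, which exposes the square of \<open>A\<close> on the left.\<close>
  have "A = U ** U' ** P ** A"
    using U' PA by simp
  also have "\<dots> = A ** P ** U' ** A"
    using UP comm by (metis matrix_mul_assoc)
  also have "\<dots> = A ** A ** (N ** U' ** A)"
    by (simp add: P_def matrix_mul_assoc)
  finally show thesis
    using that by blast
qed

text \<open>The converse is the previous implication applied to the transpose, which swaps left and
  right factors.\<close>

lemma left_square_factor_iff_right:
  fixes A :: "'a::field^'n^'n"
  shows "(\<exists>V. A = V ** A ** A) \<longleftrightarrow> (\<exists>W. A = A ** A ** W)"
proof
  show "\<exists>W. A = A ** A ** W" if "\<exists>V. A = V ** A ** A"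
    using that left_square_factor_imp_right by metis
next
  assume "\<exists>W. A = A ** A ** W"
  then have "\<exists>W. transpose A = transpose W ** transpose A ** transpose A"
    by (metis matrix_mul_assoc matrix_transpose_mul)
  then obtain V where "transpose A = transpose A ** transpose A ** V"
    using left_square_factor_imp_right by metis
  then have "A = transpose V ** A ** A"
    by (metis matrix_mul_assoc matrix_transpose_mul transpose_transpose)
  then show "\<exists>V. A = V ** A ** A" ..
qed

section \<open>Column space and rank\<close>

lemma col_space_eq_range: "col_space A = range ((*v) A)"
proof
  have "column i A = A *v axis i 1" for i
    by (simp add: vec_eq_iff column_def matrix_vector_mult_def axis_def if_distrib cong: if_cong)
  then have "columns A \<subseteq> range ((*v) A)"
    by (auto simp: columns_def)
  moreover have "vec.subspace (range ((*v) A))"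
    by (metis matrix_vector_mul_linear_gen vec.linear_subspace_image vec.subspace_UNIV)
  ultimately show "col_space A \<subseteq> range ((*v) A)"
    unfolding col_space_def by (rule vec.span_minimal)
qed (auto simp: col_space_def matrix_vector_mult_in_columnspace_gen)

lemma col_space_subset_iff: "col_space A \<subseteq> col_space B \<longleftrightarrow> (\<exists>Z. A = B ** Z)"
proof
  assume "col_space A \<subseteq> col_space B"
  then have *: "A *v x \<in> range ((*v) B)" for x
    by (auto simp: col_space_eq_range)
  obtain N where N: "B ** N ** B = B"
    using matrix_inner_inverse_exists .
  \<comment> \<open>\<open>B ** N\<close> fixes the range of \<open>B\<close>, which contains that
    of \<open>A\<close>, so \<open>N ** A\<close> serves as the factor.\<close>
  have "A *v x = (B ** (N ** A)) *v x" for x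
  proof -
    obtain y where "A *v x = B *v y"
      using * by blast
    then show ?thesis
      using N by (metis matrix_vector_mul_assoc)
  qed
  then show "\<exists>Z. A = B ** Z"
    by (metis matrix_eq)
next
  show "\<exists>Z. A = B ** Z \<Longrightarrow> col_space A \<subseteq> col_space B"
    by (auto simp: col_space_eq_range simp flip: matrix_vector_mul_assoc)
qed

lemma rank_eq_dim_row_space: "rank A = vec.dim (col_space (transpose A))"
  by (simp add: row_rank_def_gen col_space_def)

lemma row_space_mul_subset: "col_space (transpose (V ** A)) \<subseteq> col_space (transpose A)"
  by (auto simp: col_space_subset_iff matrix_transpose_mul)

lemma rank_mul_le: "rank (V ** A) \<le> rank A" for A :: "complex^'n^'m"
  by (metis rank_eq_dim_row_space row_space_mul_subset vec.dim_subset)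

text \<open>A left factor can only shrink the row space. Equal dimension forces equal row spaces,
  and this equality is a factorization of \<open>A\<close> through \<open>V ** A\<close>.\<close>

lemma rank_mul_eq_iff: "rank (V ** A) = rank A \<longleftrightarrow> (\<exists>V'. A = V' ** (V ** A))"
  for A :: "complex^'n^'m"
proof
  assume "rank (V ** A) = rank A"
  then have "col_space (transpose (V ** A)) = col_space (transpose A)"
    using row_space_mul_subset[of V A] unfolding rank_eq_dim_row_space
    by (metis col_space_def order_refl vec.subspace_dim_equal vec.subspace_span)
  then obtain Z where "transpose A = transpose (V ** A) ** Z"
    by (metis col_space_subset_iff order_refl)
  then show "\<exists>V'. A = V' ** (V ** A)"
    by (metis matrix_transpose_mul transpose_transpose)
next
  assume "\<exists>V'. A = V' ** (V ** A)"
  then show "rank (V ** A) = rank A"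
    by (metis antisym rank_mul_le)
qed

section \<open>Powers and the index\<close>

lemma mat_power_add: "mat_power A (i + j) = mat_power A i ** mat_power A j"
  by (induction i) (simp_all add: matrix_mul_assoc)

lemma mat_power_Suc_right: "mat_power A (Suc k) = mat_power A k ** A"
  using mat_power_add[of A k 1] by simp

lemma mat_power_mul_eq_mat_power:
  assumes "B ** C = C ** C"
  shows "mat_power B j ** C = mat_power C (Suc j)"
proof (induction j)
  case (Suc j)
  have "mat_power B (Suc j) ** C = B ** mat_power C (Suc j)"
    using Suc by (metis mat_power.simps(2) matrix_mul_assoc)
  also have "\<dots> = mat_power C (Suc (Suc j))"
    by (simp add: assms matrix_mul_assoc)
  finally show ?case .
qed simp

lemma rank_mat_power_stabilizes:
  fixes A :: "complex^'n^'n"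
  shows "\<exists>k>0. rank (mat_power A (k + 1)) = rank (mat_power A k)"
proof (rule ccontr)
  assume "\<not> ?thesis"
  then have less: "rank (mat_power A (Suc k)) < rank (mat_power A k)" if "k > 0" for k
    using that rank_mul_le[of A "mat_power A k"] by (metis Suc_eq_plus1 le_neq_implies_less mat_power.simps(2))
  \<comment> \<open>A strict drop at every positive exponent makes the rank fall by at least
    \<open>k\<close> between exponents 1 and \<open>k + 1\<close>, which is impossible for large
    \<open>k\<close>.\<close>
  have "rank (mat_power A (Suc k)) + k \<le> rank (mat_power A 1)" for k
  proof (induction k)
    case (Suc k)
    then show ?case
      using less[of "Suc k"] by linarith
  qed simp
  from this[of "Suc (rank (mat_power A 1))"] show False
    by simp
qed

lemma mat_index_eq_0_iff: "mat_index A = 0 \<longleftrightarrow> invertible A"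
  using LeastI_ex[OF rank_mat_power_stabilizes[of A]] by (auto simp: mat_index_def)

text \<open>Equal ranks only give a left factor, \<open>A^k = V A^(k+1)\<close>. Iterating it
  reaches \<open>A^(2k)\<close>, the square of \<open>A^k\<close>, where a left factor can be traded
  for a right one.\<close>

lemma mat_power_index_factor:
  fixes A :: "complex^'n^'n"
  obtains W where "mat_power A (mat_index A) = mat_power A (mat_index A + 1) ** W"
proof (cases "invertible A")
  case True
  then show thesis
    using that by (auto simp: mat_index_eq_0_iff[THEN iffD2]) (metis invertible_def)
next
  case False
  define k where "k = mat_index A"
  have k: "k > 0" "rank (mat_power A (k + 1)) = rank (mat_power A k)"
    using LeastI_ex[OF rank_mat_power_stabilizes[of A]] False by (simp_all add: k_def mat_index_def)
  then obtain V where V: "mat_power A k = V ** (A ** mat_power A k)"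
    using rank_mul_eq_iff[of A "mat_power A k"] by auto
  have "\<exists>V. mat_power A k = V ** mat_power A (j + k)" for j
  proof (induction j)
    case 0
    have "mat_power A k = mat 1 ** mat_power A (0 + k)"
      by simp
    then show ?case ..
  next
    case (Suc j)
    then obtain V' where "mat_power A k = V' ** mat_power A (j + k)" ..
    also have "mat_power A (j + k) = mat_power A k ** mat_power A j"
      by (simp add: mat_power_add flip: add.commute[of k j])
    also have "\<dots> = V ** mat_power A (Suc (j + k))"
      using V by (simp add: mat_power_add matrix_mul_assoc flip: add.commute[of k j])
    finally show ?case
      by (auto simp: matrix_mul_assoc)
  qed
  from this[of k] obtain V where "mat_power A k = V ** mat_power A k ** mat_power A k"
    by (auto simp: mat_power_add matrix_mul_assoc)
  then obtain W where "mat_power A k = mat_power A k ** mat_power A k ** W"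
    using left_square_factor_imp_right by metis
  \<comment> \<open>Positivity of \<open>k\<close> allows \<open>A^(2k)\<close> to be split as
    \<open>A^(k+1)\<close> times \<open>A^(k-1)\<close>.\<close>
  also have "\<dots> = mat_power A (k + 1 + (k - 1)) ** W"
    using k(1) by (simp flip: mat_power_add)
  also have "\<dots> = mat_power A (k + 1) ** (mat_power A (k - 1) ** W)"
    unfolding mat_power_add by (simp add: matrix_mul_assoc)
  finally show thesis
    using that unfolding k_def by blast
qed

section \<open>Generalized inverses\<close>

text \<open>The witness is \<open>N\<^sup>H ** A\<^sup>H\<close>, with \<open>N\<close> an inner inverse of \<open>A\<^sup>H ** A\<close>.\<close>

lemma least_squares_inverse_exists: "\<exists>G. A ** G ** A = A \<and> (A ** G)\<^sup>H = A ** G"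
proof -
  obtain N where N: "(A\<^sup>H ** A) ** N ** (A\<^sup>H ** A) = A\<^sup>H ** A"
    using matrix_inner_inverse_exists .
  then have "A\<^sup>H ** A ** (N ** A\<^sup>H ** A) = A\<^sup>H ** A ** mat 1"
    by (simp add: matrix_mul_assoc)
  from conj_transpose_mul_left_cancel[OF this]
  have *: "A ** N ** A\<^sup>H ** A = A"
    by (simp add: matrix_mul_assoc)
  define G where "G = N\<^sup>H ** A\<^sup>H"
  have AG: "(A ** G)\<^sup>H = A ** N ** A\<^sup>H"
    by (simp add: G_def conj_transpose_mul matrix_mul_assoc)
  have "(A ** G)\<^sup>H ** A = A"
    by (simp add: AG *)
  then have "(A ** G)\<^sup>H ** (A ** G) = A ** G"
    by (simp add: matrix_mul_assoc)
  moreover from this have "(A ** G)\<^sup>H = (A ** G)\<^sup>H ** (A ** G)"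
    by (metis conj_transpose_mul conj_transpose_conj_transpose)
  ultimately have "(A ** G)\<^sup>H = A ** G"
    by simp
  with \<open>(A ** G)\<^sup>H ** A = A\<close> show ?thesis
    by auto
qed

lemma moore_penrose_spec:
  "A ** moore_penrose A ** A = A \<and> moore_penrose A ** A ** moore_penrose A = moore_penrose A \<and>
   (A ** moore_penrose A)\<^sup>H = A ** moore_penrose A \<and>
   (moore_penrose A ** A)\<^sup>H = moore_penrose A ** A"
  unfolding moore_penrose_def
proof (rule theI')
  obtain G where G: "A ** G ** A = A" "(A ** G)\<^sup>H = A ** G"
    using least_squares_inverse_exists[of A] by auto
  obtain F where "A\<^sup>H ** F ** A\<^sup>H = A\<^sup>H" "(A\<^sup>H ** F)\<^sup>H = A\<^sup>H ** F"
    using least_squares_inverse_exists[of "A\<^sup>H"] by auto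
  then have F: "A ** F\<^sup>H ** A = A" "(F\<^sup>H ** A)\<^sup>H = F\<^sup>H ** A"
    by (metis conj_transpose_conj_transpose conj_transpose_mul matrix_mul_assoc)+
  \<comment> \<open>\<open>G\<close> makes \<open>A G\<close> Hermitian and \<open>F\<^sup>H\<close>
    makes \<open>F\<^sup>H A\<close> Hermitian; the product \<open>X\<close> inherits both
    properties.\<close>
  define X where "X = F\<^sup>H ** A ** G"
  have AX: "A ** X = A ** G" and XA: "X ** A = F\<^sup>H ** A"
    using F G by (metis X_def matrix_mul_assoc)+
  have "X ** A ** X = X"
    using F(1) by (metis XA X_def matrix_mul_assoc)
  then have X: "A ** X ** A = A \<and> X ** A ** X = X \<and> (A ** X)\<^sup>H = A ** X \<and> (X ** A)\<^sup>H = X ** A"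
    using F G by (simp add: AX XA)
  show "\<exists>!X. A ** X ** A = A \<and> X ** A ** X = X \<and> (A ** X)\<^sup>H = A ** X \<and> (X ** A)\<^sup>H = X ** A"
  proof (rule ex1I[of _ X])
    show "A ** X ** A = A \<and> X ** A ** X = X \<and> (A ** X)\<^sup>H = A ** X \<and> (X ** A)\<^sup>H = X ** A"
      by (rule X)
    fix Y assume Y: "A ** Y ** A = A \<and> Y ** A ** Y = Y \<and> (A ** Y)\<^sup>H = A ** Y \<and> (Y ** A)\<^sup>H = Y ** A"
    have "A ** X = A ** Y ** (A ** X)"
      using Y by (metis matrix_mul_assoc)
    \<comment> \<open>Taking conjugate transposes swaps the two Hermitian factors.\<close>
    then have "A ** X = A ** X ** (A ** Y)"
      using X Y by (metis conj_transpose_mul)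
    then have 1: "A ** X = A ** Y"
      using X by (metis matrix_mul_assoc)
    have "X ** A = X ** A ** (Y ** A)"
      using Y by (metis matrix_mul_assoc)
    then have "X ** A = Y ** A ** (X ** A)"
      using X Y by (metis conj_transpose_mul)
    then have 2: "X ** A = Y ** A"
      using X by (metis matrix_mul_assoc)
    show "Y = X"
      using X Y 1 2 by (metis matrix_mul_assoc)
  qed
qed

lemma core_invertible_iff_left: "core_invertible A \<longleftrightarrow> (\<exists>V. A = V ** A ** A)"
  using rank_mul_eq_iff[of A A] by (simp add: core_invertible_def numeral_2_eq_2 matrix_mul_assoc)

lemma core_invertible_iff_right: "core_invertible A \<longleftrightarrow> (\<exists>W. A = A ** A ** W)"
  by (simp add: core_invertible_iff_left left_square_factor_iff_right)

lemma core_invertible_mat_power_factor: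
  assumes "core_invertible A"
  obtains Z where "A = mat_power A (Suc j) ** Z"
proof -
  obtain W where W: "A = A ** A ** W"
    using assms core_invertible_iff_right by blast
  have "\<exists>Z. A = mat_power A (Suc j) ** Z"
  proof (induction j)
    case 0
    have "A = mat_power A (Suc 0) ** mat 1"
      by simp
    then show ?case ..
  next
    case (Suc j)
    then obtain Z where Z: "A = mat_power A (Suc j) ** Z" ..
    have "A = A ** (mat_power A (Suc j) ** Z) ** W"
      by (subst Z[symmetric]) (rule W)
    then have "A = mat_power A (Suc (Suc j)) ** (Z ** W)"
      by (simp add: matrix_mul_assoc)
    then show ?case ..
  qed
  then show thesis
    using that by blast
qed

text \<open>The right factor \<open>W\<close> yields a witness for the definite description. The
  left factor \<open>V\<close> yields uniqueness: \<open>V ** A\<close> fixes the range of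
  \<open>A\<close>, so any solution equals \<open>V A A\<^sup>\<dagger>\<close>, with the last
  factor the Moore-Penrose inverse.\<close>

lemma core_inverse_spec:
  assumes "core_invertible A"
  defines "X \<equiv> core_inverse A"
  shows "A ** X ** A = A" "X ** A ** X = X" "X ** A ** A = A" "(A ** X)\<^sup>H = A ** X"
    "\<exists>S. X = A ** S"
proof -
  let ?G = "moore_penrose A"
  obtain V where V: "A = V ** A ** A"
    using assms core_invertible_iff_left by blast
  obtain W where W: "A = A ** A ** W"
    using assms core_invertible_iff_right by blast
  have ex: "A ** (A ** W ** ?G) = A ** ?G \<and> col_space (A ** W ** ?G) \<subseteq> col_space A"
  proof
    show "A ** (A ** W ** ?G) = A ** ?G"
      unfolding matrix_mul_assoc W[symmetric] ..
    show "col_space (A ** W ** ?G) \<subseteq> col_space A"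
      unfolding col_space_subset_iff by (metis matrix_mul_assoc)
  qed
  have eq: "Y = V ** A ** ?G" if Y: "A ** Y = A ** ?G \<and> col_space Y \<subseteq> col_space A" for Y
  proof -
    obtain Z where "Y = A ** Z"
      using Y col_space_subset_iff by blast
    then have "Y = V ** A ** Y"
      using V by (metis matrix_mul_assoc)
    then show ?thesis
      using Y by (metis matrix_mul_assoc)
  qed
  have X: "A ** X = A ** ?G \<and> col_space X \<subseteq> col_space A"
    unfolding X_def core_inverse_def
    by (rule theI[where a = "A ** W ** ?G"]) (use ex eq in metis)+
  show S: "\<exists>S. X = A ** S"
    using X col_space_subset_iff by blast
  show AXA: "A ** X ** A = A" and "(A ** X)\<^sup>H = A ** X"
    using X moore_penrose_spec by metis+
  have VAX: "X = V ** A ** X"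
    using V S by (metis matrix_mul_assoc)
  have XA: "X ** A = V ** A"
    using AXA by (subst VAX) (metis matrix_mul_assoc)
  show "X ** A ** X = X" "X ** A ** A = A"
    unfolding XA by (rule VAX[symmetric] V[symmetric])+
qed

text \<open>The first equation says that \<open>X ** A\<close> fixes the range of
  \<open>A^k\<close>, where \<open>k\<close> is the index. Two solutions have their columns there,
  so each absorbs the other; the Hermitian condition then gives \<open>A X = A Y\<close>.\<close>

lemma core_EP_inverse_eqI:
  assumes X: "X ** mat_power A (mat_index A + 1) = mat_power A (mat_index A)"
    "X ** A ** X = X" "(A ** X)\<^sup>H = A ** X"
    "col_space X \<subseteq> col_space (mat_power A (mat_index A))"
  shows "core_EP_inverse A = X"
  unfolding core_EP_inverse_def
proof (rule the_equality)
  let ?M = "mat_power A (mat_index A)"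
  fix Y
  assume Y: "Y ** mat_power A (mat_index A + 1) = ?M \<and> Y ** A ** Y = Y \<and> (A ** Y)\<^sup>H = A ** Y \<and>
    col_space Y \<subseteq> col_space ?M"
  have "X ** A ** ?M = ?M" "Y ** A ** ?M = ?M"
    using X Y by (simp_all add: matrix_mul_assoc)
  moreover obtain S T where "X = ?M ** S" "Y = ?M ** T"
    using X Y col_space_subset_iff by metis
  ultimately have XY: "X ** A ** Y = Y" "Y ** A ** X = X"
    by (metis matrix_mul_assoc)+
  have "A ** X = A ** Y ** (A ** X)"
    using XY by (metis matrix_mul_assoc)
  then have "A ** X = A ** X ** (A ** Y)"
    using X Y by (metis conj_transpose_mul)
  also have "\<dots> = A ** Y"
    using XY by (metis matrix_mul_assoc)
  finally show "Y = X"
    using X Y XY by (metis matrix_mul_assoc)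
qed (use assms in blast)

section \<open>The core-EP decomposition\<close>

text \<open>\<open>P\<close> is the orthogonal projector onto the range of \<open>M = A^k\<close>,
  with \<open>k\<close> the index. This range is invariant under \<open>A\<close>, whence
  \<open>P A P = A P\<close>; the parts are \<open>P A\<close> and \<open>(I - P) A\<close>.\<close>

lemma core_EP_decomposition_exists:
  obtains A1 A2 where "core_EP_decomposition A A1 A2"
proof -
  define M where "M = mat_power A (mat_index A)"
  define P where "P = M ** moore_penrose M"
  define A1 where "A1 = P ** A"
  define A2 where "A2 = A - P ** A"
  have PM: "P ** M = M" and PH: "P\<^sup>H = P"
    using moore_penrose_spec[of M] by (simp_all add: P_def)
  have AM: "A ** M = M ** A"
    unfolding M_def by (metis mat_power.simps(2) mat_power_Suc_right)
  have PP: "P ** P = P"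
    using PM by (metis P_def matrix_mul_assoc)
  have PAM: "P ** (A ** M) = A ** M"
    using PM AM by (metis matrix_mul_assoc)
  have PAP: "P ** A ** P = A ** P"
    using PAM by (metis P_def matrix_mul_assoc)
  obtain W where W: "M = A ** M ** W"
    using mat_power_index_factor[of A] by (auto simp: M_def matrix_mul_assoc)
  then have "M = A ** (A ** M ** W) ** W"
    by simp
  then have W2: "M = A ** A ** M ** (W ** W)"
    by (simp add: matrix_mul_assoc)
  have "A1 ** A1 = A ** P ** A"
    using PAP by (metis A1_def matrix_mul_assoc)
  then have "A1 ** A1 ** (M ** (W ** W) ** moore_penrose M ** A)
      = A ** (P ** (A ** M)) ** (W ** W) ** moore_penrose M ** A"
    by (simp add: matrix_mul_assoc)
  also have "\<dots> = (A ** A ** M ** (W ** W)) ** moore_penrose M ** A"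
    unfolding PAM by (simp add: matrix_mul_assoc)
  also have "\<dots> = A1"
    by (simp only: W2[symmetric] A1_def P_def)
  finally have core: "core_invertible A1"
    unfolding core_invertible_iff_right by metis
  have pow: "mat_power A2 (Suc j) = (mat 1 - P) ** mat_power A (Suc j)" for j
  proof (induction j)
    case 0
    then show ?case
      by (simp add: A2_def matrix_sub_rdistrib)
  next
    case (Suc j)
    have "A2 ** (mat 1 - P) = A2"
      using PAP by (simp add: A2_def matrix_sub_ldistrib matrix_sub_rdistrib matrix_mul_assoc)
    then have "mat_power A2 (Suc (Suc j)) = A2 ** mat_power A (Suc j)"
      using Suc by (metis mat_power.simps(2) matrix_mul_assoc)
    then show ?case
      by (simp add: A2_def matrix_sub_rdistrib matrix_mul_assoc)
  qed
  have nil: "if mat_index A = 0 then A2 = 0 else mat_power A2 (mat_index A) = 0"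
  proof (cases "mat_index A")
    case 0
    then have "P = mat 1"
      using PM by (simp add: M_def)
    then show ?thesis
      using 0 by (simp add: A2_def)
  next
    case (Suc j)
    then have "mat_power A2 (mat_index A) = M - P ** M"
      using pow by (simp add: M_def matrix_sub_rdistrib)
    then show ?thesis
      using PM Suc by simp
  qed
  have "A1\<^sup>H ** A2 = 0"
    by (simp add: A1_def A2_def conj_transpose_mul PH matrix_sub_ldistrib PP matrix_mul_prolong[OF PP]
        flip: matrix_mul_assoc)
  moreover have "A2 ** A1 = 0"
    using PAP by (simp add: A1_def A2_def matrix_sub_rdistrib matrix_mul_assoc)
  ultimately have "core_EP_decomposition A A1 A2"
    using core nil unfolding core_EP_decomposition_def by (simp add: A1_def A2_def)
  then show thesis
    using that by blast
qed

text \<open>In the expansion of \<open>(A1 + A2)^j\<close>, words containing \<open>A2 A1\<close>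
  vanish, so \<open>A2^j\<close> is the only surviving word not starting with \<open>A1\<close> when
  \<open>j > 0\<close>. It is zero at a positive index.\<close>

lemma mat_power_index_core_part_factor:
  assumes "core_EP_decomposition A A1 A2"
  obtains T where "mat_power A (mat_index A) = A1 ** T"
proof (cases "mat_index A = 0")
  case True
  then have "A1 = A" "invertible A"
    using assms by (simp_all add: core_EP_decomposition_def mat_index_eq_0_iff)
  then show thesis
    using that True unfolding invertible_def by (metis mat_power.simps(1))
next
  case False
  have A: "A = A1 + A2" "A2 ** A1 = 0"
    using assms by (simp_all add: core_EP_decomposition_def)
  have "\<exists>T. mat_power A j = A1 ** T + mat_power A2 j" for j
  proof (induction j)
    case 0
    have "mat_power A 0 = A1 ** 0 + mat_power A2 0"
      by simp
    then show ?case ..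
  next
    case (Suc j)
    then obtain T where T: "mat_power A j = A1 ** T + mat_power A2 j" ..
    have "A2 ** mat_power A j = mat_power A2 (Suc j)"
      using A(2) by (simp add: T matrix_add_ldistrib matrix_mul_prolong[OF A(2)])
    then have "mat_power A (Suc j) = A1 ** mat_power A j + mat_power A2 (Suc j)"
      by (subst mat_power.simps, subst A(1)) (simp add: matrix_add_rdistrib)
    then show ?case ..
  qed
  from this[of "mat_index A"] show thesis
    using that False assms by (auto simp: core_EP_decomposition_def)
qed

lemma core_EP_decomposition_core_inverse:
  assumes "core_EP_decomposition A A1 A2"
  defines "X \<equiv> core_inverse A1"
  shows "core_EP_inverse A = X" "X ** A = X ** A1" "A ** X = A1 ** X" "A ** X ** A = A1"
proof -
  let ?k = "mat_index A"
  have A: "A = A1 + A2" "A1\<^sup>H ** A2 = 0" "A2 ** A1 = 0" and core: "core_invertible A1"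
    using assms by (simp_all add: core_EP_decomposition_def)
  note X = core_inverse_spec[OF core, folded X_def]
  obtain S where S: "X = A1 ** S"
    using X by blast
  \<comment> \<open>Hermitian symmetry of \<open>A1 X\<close> brings \<open>A1\<^sup>H\<close> next
    to \<open>A2\<close>, where orthogonality applies.\<close>
  have "A1 ** X = X\<^sup>H ** A1\<^sup>H"
    using X(4) by (simp add: conj_transpose_mul)
  then have "A1 ** X ** A2 = 0"
    using A(2) by (simp flip: matrix_mul_assoc)
  then have "X ** A2 = 0"
    using X(2) by (metis matrix_mul_assoc times0_right)
  then show XA: "X ** A = X ** A1"
    by (simp add: A(1) matrix_add_ldistrib)
  have "A2 ** X = 0"
    using A(3) by (simp add: S matrix_mul_assoc)
  then show AX: "A ** X = A1 ** X"
    by (simp add: A(1) matrix_add_rdistrib)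
  show "A ** X ** A = A1"
    using X(1) XA AX by (metis matrix_mul_assoc)
  have AA1: "A ** A1 = A1 ** A1"
    by (simp add: A matrix_add_rdistrib)
  note pow = mat_power_mul_eq_mat_power[OF AA1]
  obtain T where T: "mat_power A ?k = A1 ** T"
    using mat_power_index_core_part_factor[OF assms(1)] .
  show "core_EP_inverse A = X"
  proof (rule core_EP_inverse_eqI)
    have "X ** A ** mat_power A ?k = mat_power A ?k"
      using T XA X(3) by (metis matrix_mul_assoc)
    then show "X ** mat_power A (?k + 1) = mat_power A ?k"
      by (simp add: matrix_mul_assoc)
    show "X ** A ** X = X" "(A ** X)\<^sup>H = A ** X"
      using X(2,4) by (simp_all add: XA AX)
    \<comment> \<open>The exponent is \<open>k + 1\<close> because \<open>A^k A1 = A1^(k+1)\<close>;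
      this places the columns of \<open>A1\<close>, and so of \<open>X\<close>, in the range of
      \<open>A^k\<close>.\<close>
    obtain Z where "A1 = mat_power A1 (Suc ?k) ** Z"
      using core_invertible_mat_power_factor[OF core] .
    then have "X = mat_power A ?k ** (A1 ** Z ** S)"
      unfolding pow[symmetric] S by (metis matrix_mul_assoc)
    then show "col_space X \<subseteq> col_space (mat_power A ?k)"
      using col_space_subset_iff by blast
  qed
qed

text \<open>The factorization through \<open>B1\<close> makes \<open>X = core_inverse A1\<close>
  annihilate \<open>B2\<close> from both sides: \<open>X\<close> ends in \<open>B1\<^sup>H\<close>
  because \<open>A1 X\<close> is Hermitian, and begins with \<open>B1\<close> because
  \<open>X = A1 S\<close>.\<close>

lemma core_part_factor_absorb:
  assumes A: "core_EP_decomposition A A1 A2" and B: "core_EP_decomposition B B1 B2"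
    and Z: "A1 = B1 ** Z"
  shows "core_inverse A1 ** B = core_inverse A1 ** B1" "B ** core_inverse A1 = B1 ** core_inverse A1"
proof -
  define X where "X = core_inverse A1"
  have "core_invertible A1"
    using A by (simp add: core_EP_decomposition_def)
  note X = core_inverse_spec[OF this, folded X_def]
  have B: "B = B1 + B2" "B1\<^sup>H ** B2 = 0" "B2 ** B1 = 0"
    using B by (simp_all add: core_EP_decomposition_def)
  have "X = X ** (A1 ** X)\<^sup>H"
    using X(2,4) by (simp add: matrix_mul_assoc)
  also have "\<dots> = X ** X\<^sup>H ** Z\<^sup>H ** B1\<^sup>H"
    by (simp add: Z conj_transpose_mul matrix_mul_assoc)
  finally have "X ** B2 = X ** X\<^sup>H ** Z\<^sup>H ** B1\<^sup>H ** B2"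
    by simp
  also have "\<dots> = 0"
    using B(2) by (simp flip: matrix_mul_assoc)
  finally show "core_inverse A1 ** B = core_inverse A1 ** B1"
    by (simp add: B(1) matrix_add_ldistrib flip: X_def)
  have "B2 ** X = 0"
    using X(5) Z B(3) by (auto simp: matrix_mul_assoc)
  then show "B ** core_inverse A1 = B1 ** core_inverse A1"
    by (simp add: B(1) matrix_add_rdistrib flip: X_def)
qed

lemma core_EP_le_imp_core_part_factor:
  assumes A: "core_EP_decomposition A A1 A2" and B: "core_EP_decomposition B B1 B2"
    and le: "core_EP_le A B"
  obtains Z where "A1 = B1 ** Z"
proof -
  define X where "X = core_inverse A1"
  have core: "core_invertible A1"
    using A by (simp add: core_EP_decomposition_def)
  note X = core_inverse_spec[OF core, folded X_def]
  note AX = core_EP_decomposition_core_inverse[OF A, folded X_def]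
  have "B ** X = A1 ** X"
    using le AX(1,3) by (simp add: core_EP_le_def)
  \<comment> \<open>Right multiplication by \<open>A1 ** A1\<close> removes \<open>X\<close>, as
    \<open>X A1 A1 = A1\<close>.\<close>
  then have BA1: "B ** A1 = A1 ** A1"
    using X(3) by (metis matrix_mul_assoc)
  note pow = mat_power_mul_eq_mat_power[OF BA1]
  obtain T where T: "mat_power B (mat_index B) = B1 ** T"
    using mat_power_index_core_part_factor[OF B] .
  obtain W where "A1 = mat_power A1 (Suc (mat_index B)) ** W"
    using core_invertible_mat_power_factor[OF core] .
  then have "A1 = B1 ** (T ** A1 ** W)"
    using pow T by (metis matrix_mul_assoc)
  then show thesis
    using that by blast
qed

lemma core_le_iff_core_EP_le:
  assumes A: "core_EP_decomposition A A1 A2" and B: "core_EP_decomposition B B1 B2"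
  shows "core_le A1 B1 \<longleftrightarrow> core_EP_le A B"
proof -
  define X where "X = core_inverse A1"
  have core: "core_invertible A1" "core_invertible B1"
    using A B by (simp_all add: core_EP_decomposition_def)
  note X = core_inverse_spec[OF core(1), folded X_def]
  note AX = core_EP_decomposition_core_inverse[OF A, folded X_def]
  note absorb = core_part_factor_absorb[OF A B, folded X_def]
  have le1: "core_le A1 B1 \<longleftrightarrow> X ** A1 = X ** B1 \<and> A1 ** X = B1 ** X"
    using core by (simp add: core_le_def X_def)
  have le2: "core_EP_le A B \<longleftrightarrow> X ** A1 = X ** B \<and> A1 ** X = B ** X"
    by (simp add: core_EP_le_def AX)
  show ?thesis
  proof
    assume le: "core_le A1 B1"
    \<comment> \<open>The core order replaces \<open>A1 X\<close> by \<open>B1 X\<close> in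
      \<open>A1 = A1 X A1\<close>.\<close>
    then have "A1 = B1 ** (X ** A1)"
      using X(1) by (metis le1 matrix_mul_assoc)
    then show "core_EP_le A B"
      using le absorb by (metis le1 le2)
  next
    assume le: "core_EP_le A B"
    then obtain Z where "A1 = B1 ** Z"
      using core_EP_le_imp_core_part_factor[OF A B] by blast
    then show "core_le A1 B1"
      using le absorb by (metis le1 le2)
  qed
qed

theorem theorem5p4:
  fixes A B :: "complex^'n^'n"
  shows "core_minus_le A B \<longleftrightarrow>
    core_EP_le A B \<and>
    minus_le (A - A ** core_EP_inverse A ** A) (B - B ** core_EP_inverse B ** B)"
proof -
  \<comment> \<open>The formula holds for every core-EP decomposition, so it covers both those
    constructed below and those supplied by \<open>core_minus_le\<close>.\<close>
  have nilpotent: "A2 = A - A ** core_EP_inverse A ** A" if "core_EP_decomposition A A1 A2"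
    for A A1 A2 :: "complex^'n^'n"
  proof -
    have "A = A1 + A2"
      using that by (simp add: core_EP_decomposition_def)
    then show ?thesis
      using core_EP_decomposition_core_inverse[OF that] by (metis add_diff_cancel_left')
  qed
  obtain A1 A2 where A: "core_EP_decomposition A A1 A2"
    using core_EP_decomposition_exists .
  obtain B1 B2 where B: "core_EP_decomposition B B1 B2"
    using core_EP_decomposition_exists .
  show ?thesis
  proof
    assume "core_minus_le A B"
    then obtain A1 A2 B1 B2 where A: "core_EP_decomposition A A1 A2"
      and B: "core_EP_decomposition B B1 B2" and le: "core_le A1 B1" "minus_le A2 B2"
      unfolding core_minus_le_def by blast
    show "core_EP_le A B \<and>
        minus_le (A - A ** core_EP_inverse A ** A) (B - B ** core_EP_inverse B ** B)"
      using le core_le_iff_core_EP_le[OF A B] by (simp flip: nilpotent[OF A] nilpotent[OF B])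
  next
    assume "core_EP_le A B \<and>
        minus_le (A - A ** core_EP_inverse A ** A) (B - B ** core_EP_inverse B ** B)"
    then have "core_le A1 B1" "minus_le A2 B2"
      using core_le_iff_core_EP_le[OF A B] by (simp_all flip: nilpotent[OF A] nilpotent[OF B])
    then show "core_minus_le A B"
      unfolding core_minus_le_def using A B by blast
  qed
qed

end
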